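(* The only proper non-trivial multiple-conclusion extensions of $\mathsf{BD}_{mc}$ are $\mathsf{KO}_{mc}$, $\mathsf{K}_{mc}$, $\mathsf{LP}_{mc}$ and $\mathsf{CL}_{mc}$.
   Context: Formulas are built from a countably infinite set of variables using $\wedge,\vee$, ${\sim}$, $\top,\bot$. A multiple-conclusion logic is a relation $\Gamma\vdash\Delta$ between sets of formulas satisfying: $\varphi\vdash\varphi$; if $\Gamma\vdash\Delta$ then $\Gamma,\Gamma'\vdash\Delta,\Delta'$; (cut) if $\Gamma,\Phi_1\vdash\Delta,\Phi_2$ for every partition... more precisely, if $\Gamma,\Phi_1\vdash\Delta$ or $\Gamma\vdash\Delta,\Phi_2$ holds whenever $\Phi_1\cup\Phi_2=\Phi$ (for a fixed set $\Phi$), then $\Gamma\vdash\Delta$; and if $\Gamma\vdash\Delta$ then $\sigma[\Gamma]\vdash\sigma[\Delta]$ for each substitution $\sigma$. An extension is a multiple-conclusion logic containing the given one; the trivial one contains all pairs. For a class of matrices $\mathcal K$ (algebras with a designated subset $F$), its multiple-conclusion logic has $\Gamma\vdash\Delta$ iff for every matrix in $\mathcal K$ and valuation $v$ with $v[\Gamma]\subseteq F$ there is $\delta\in\Delta$ with $v(\delta)\in F$. Let $\mathbf{DM}_4$ be the De Morgan algebra on $\{\bot,n,b,\top\}$ with $\bot<n,b<\top$ ($n,b$ incomparable), ${\sim}$ swapping $\top,\bot$ and fixing $n,b$. $\mathsf{BD}_{mc}$, $\mathsf{K}_{mc}$, $\mathsf{LP}_{mc}$, $\mathsf{CL}_{mc}$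 are the multiple-conclusion logics of the matrices $\langle\mathbf{DM}_4,\{b,\top\}\rangle$, $\langle\{\bot,n,\top\},\{\top\}\rangle$, $\langle\{\bot,b,\top\},\{b,\top\}\rangle$, $\langle\{\bot,\top\},\{\top\}\rangle$ (subalgebras of $\mathbf{DM}_4$), and $\mathsf{KO}_{mc}=\mathsf{LP}_{mc}\cap\mathsf{K}_{mc}$. *)

theory Defs
  imports Main
begin

datatype fm =
    Var nat
  | Conj fm fm
  | Disj fm fm
  | Neg fm
  | Verum
  | Falsum

primrec subst :: "(nat \<Rightarrow> fm) \<Rightarrow> fm \<Rightarrow> fm" where
  "subst \<sigma> (Var x) = \<sigma> x"
| "subst \<sigma> (Conj \<phi> \<psi>) = Conj (subst \<sigma> \<phi>) (subst \<sigma> \<psi>)"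
| "subst \<sigma> (Disj \<phi> \<psi>) = Disj (subst \<sigma> \<phi>) (subst \<sigma> \<psi>)"
| "subst \<sigma> (Neg \<phi>) = Neg (subst \<sigma> \<phi>)"
| "subst \<sigma> Verum = Verum"
| "subst \<sigma> Falsum = Falsum"

text \<open>A pair \<open>(\<Gamma>, \<Delta>)\<close> in a relation stands for \<open>\<Gamma> \<turnstile> \<Delta>\<close>.\<close>

type_synonym mc_rel = "(fm set \<times> fm set) set"

text \<open>
  The premise of the cut rule below is a disjunction for each cover of \<open>\<Phi>\<close>. In the presence of
  weakening this rule follows from the one of Shoesmith and Smiley, whose premise is
  \<open>\<Gamma>, \<Phi>\<^sub>1 \<turnstile> \<Delta>, \<Phi>\<^sub>2\<close> for each cover (lemma \<open>full_cut_imp_cut\<close>); the logic of a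
  class of matrices satisfies both (lemma \<open>matrix_logic_full_cut\<close>).
\<close>

definition mc_logic :: "mc_rel \<Rightarrow> bool" where
  "mc_logic L \<longleftrightarrow>
     (\<forall>\<phi>. ({\<phi>}, {\<phi>}) \<in> L) \<and>
     (\<forall>\<Gamma> \<Delta> \<Gamma>' \<Delta>'. (\<Gamma>, \<Delta>) \<in> L \<longrightarrow> (\<Gamma> \<union> \<Gamma>', \<Delta> \<union> \<Delta>') \<in> L) \<and>
     (\<forall>\<Gamma> \<Delta> \<Phi>. (\<forall>\<Phi>\<^sub>1 \<Phi>\<^sub>2. \<Phi>\<^sub>1 \<union> \<Phi>\<^sub>2 = \<Phi> \<longrightarrow> (\<Gamma> \<union> \<Phi>\<^sub>1, \<Delta>) \<in> L \<or> (\<Gamma>, \<Delta> \<union> \<Phi>\<^sub>2) \<in> L)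
        \<longrightarrow> (\<Gamma>, \<Delta>) \<in> L) \<and>
     (\<forall>\<Gamma> \<Delta> \<sigma>. (\<Gamma>, \<Delta>) \<in> L \<longrightarrow> (subst \<sigma> ` \<Gamma>, subst \<sigma> ` \<Delta>) \<in> L)"

definition mc_extension :: "mc_rel \<Rightarrow> mc_rel \<Rightarrow> bool" where
  "mc_extension L L' \<longleftrightarrow> mc_logic L' \<and> L \<subseteq> L'"

definition trivial_mc :: mc_rel where
  "trivial_mc = UNIV"

record 'a matrix =
  carrier :: "'a set"
  conj_op :: "'a \<Rightarrow> 'a \<Rightarrow> 'a"
  disj_op :: "'a \<Rightarrow> 'a \<Rightarrow> 'a"
  neg_op :: "'a \<Rightarrow> 'a"
  top_op :: 'a
  bot_op :: 'a
  designated :: "'a set"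

definition is_matrix :: "'a matrix \<Rightarrow> bool" where
  "is_matrix M \<longleftrightarrow>
     (\<forall>x \<in> carrier M. \<forall>y \<in> carrier M. conj_op M x y \<in> carrier M \<and> disj_op M x y \<in> carrier M) \<and>
     (\<forall>x \<in> carrier M. neg_op M x \<in> carrier M) \<and>
     top_op M \<in> carrier M \<and> bot_op M \<in> carrier M \<and> designated M \<subseteq> carrier M"

primrec eval :: "'a matrix \<Rightarrow> (nat \<Rightarrow> 'a) \<Rightarrow> fm \<Rightarrow> 'a" where
  "eval M v (Var x) = v x"
| "eval M v (Conj \<phi> \<psi>) = conj_op M (eval M v \<phi>) (eval M v \<psi>)"
| "eval M v (Disj \<phi> \<psi>) = disj_op M (eval M v \<phi>) (eval M v \<psi>)"
| "eval M v (Neg \<phi>) = neg_op M (eval M v \<phi>)"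
| "eval M v Verum = top_op M"
| "eval M v Falsum = bot_op M"

definition matrix_logic :: "'a matrix set \<Rightarrow> mc_rel" where
  "matrix_logic K =
     {(\<Gamma>, \<Delta>). \<forall>M \<in> K. \<forall>v. range v \<subseteq> carrier M \<longrightarrow> eval M v ` \<Gamma> \<subseteq> designated M \<longrightarrow>
                  (\<exists>\<delta> \<in> \<Delta>. eval M v \<delta> \<in> designated M)}"

datatype dm4 = F4 | N4 | B4 | T4

text \<open>
  Only the order is the actual content here: the instance proof makes \<^const>\<open>inf\<close> and
  \<^const>\<open>sup\<close> the meet and join of the order in which \<^const>\<open>N4\<close> and \<^const>\<open>B4\<close> are
  incomparable, with least element \<^const>\<open>F4\<close> and greatest element \<^const>\<open>T4\<close>.
\<close>

instantiation dm4 :: bounded_lattice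
begin

definition less_eq_dm4 :: "dm4 \<Rightarrow> dm4 \<Rightarrow> bool" where
  "x \<le> y \<longleftrightarrow> x = y \<or> x = F4 \<or> y = T4"

definition less_dm4 :: "dm4 \<Rightarrow> dm4 \<Rightarrow> bool" where
  "x < y \<longleftrightarrow> x \<le> y \<and> x \<noteq> (y :: dm4)"

definition inf_dm4 :: "dm4 \<Rightarrow> dm4 \<Rightarrow> dm4" where
  "inf x y = (if x \<le> y then x else if y \<le> x then y else F4)"

definition sup_dm4 :: "dm4 \<Rightarrow> dm4 \<Rightarrow> dm4" where
  "sup x y = (if x \<le> y then y else if y \<le> x then x else T4)"

definition bot_dm4 :: dm4 where "bot = F4"

definition top_dm4 :: dm4 where "top = T4"

instance
proof
  fix x y z :: dm4
  note defs = less_eq_dm4_def less_dm4_def inf_dm4_def sup_dm4_def bot_dm4_def top_dm4_def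
  show "x < y \<longleftrightarrow> x \<le> y \<and> \<not> y \<le> x"
    by (cases x; cases y) (simp_all add: defs)
  show "x \<le> x" "bot \<le> x" "x \<le> top"
    by (simp_all add: defs)
  show "x \<le> z" if "x \<le> y" "y \<le> z"
    using that by (cases x; cases y; cases z) (simp_all add: defs)
  show "x = y" if "x \<le> y" "y \<le> x"
    using that by (cases x; cases y) (simp_all add: defs)
  show "inf x y \<le> x" "inf x y \<le> y" "x \<le> sup x y" "y \<le> sup x y"
    by (cases x; cases y; simp add: defs)+
  show "x \<le> inf y z" if "x \<le> y" "x \<le> z"
    using that by (cases x; cases y; cases z) (simp_all add: defs)
  show "sup y z \<le> x" if "y \<le> x" "z \<le> x"
    using that by (cases x; cases y; cases z) (simp_all add: defs)
qed

end

primrec neg4 :: "dm4 \<Rightarrow> dm4" where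
  "neg4 F4 = T4"
| "neg4 N4 = N4"
| "neg4 B4 = B4"
| "neg4 T4 = F4"

definition dm4_matrix :: "dm4 set \<Rightarrow> dm4 set \<Rightarrow> dm4 matrix" where
  "dm4_matrix A F =
     \<lparr>carrier = A, conj_op = inf, disj_op = sup, neg_op = neg4, top_op = top, bot_op = bot,
      designated = F\<rparr>"

definition BD_mc :: mc_rel where
  "BD_mc = matrix_logic {dm4_matrix UNIV {B4, T4}}"

definition K_mc :: mc_rel where
  "K_mc = matrix_logic {dm4_matrix {F4, N4, T4} {T4}}"

definition LP_mc :: mc_rel where
  "LP_mc = matrix_logic {dm4_matrix {F4, B4, T4} {B4, T4}}"

definition CL_mc :: mc_rel where
  "CL_mc = matrix_logic {dm4_matrix {F4, T4} {T4}}"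

definition KO_mc :: mc_rel where
  "KO_mc = LP_mc \<inter> K_mc"

lemma neg4_neg4: "neg4 (neg4 x) = x"
  by (cases x) simp_all

lemma neg4_sup: "neg4 (sup x y) = inf (neg4 x) (neg4 y)"
  by (cases x; cases y) (simp_all add: less_eq_dm4_def inf_dm4_def sup_dm4_def)

lemma is_matrix_BD: "is_matrix (dm4_matrix UNIV {B4, T4})"
  and is_matrix_K: "is_matrix (dm4_matrix {F4, N4, T4} {T4})"
  and is_matrix_LP: "is_matrix (dm4_matrix {F4, B4, T4} {B4, T4})"
  and is_matrix_CL: "is_matrix (dm4_matrix {F4, T4} {T4})"
  by (simp_all add: is_matrix_def dm4_matrix_def less_eq_dm4_def inf_dm4_def sup_dm4_def
      bot_dm4_def top_dm4_def)

lemma full_cut_imp_cut: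
  assumes weak: "\<And>\<Gamma> \<Delta> \<Gamma>' \<Delta>'. (\<Gamma>, \<Delta>) \<in> L \<Longrightarrow> (\<Gamma> \<union> \<Gamma>', \<Delta> \<union> \<Delta>') \<in> L"
    and full: "(\<And>\<Phi>\<^sub>1 \<Phi>\<^sub>2. \<Phi>\<^sub>1 \<union> \<Phi>\<^sub>2 = \<Phi> \<Longrightarrow> (\<Gamma> \<union> \<Phi>\<^sub>1, \<Delta> \<union> \<Phi>\<^sub>2) \<in> L) \<Longrightarrow> (\<Gamma>, \<Delta>) \<in> L"
    and prem: "\<And>\<Phi>\<^sub>1 \<Phi>\<^sub>2. \<Phi>\<^sub>1 \<union> \<Phi>\<^sub>2 = \<Phi> \<Longrightarrow> (\<Gamma> \<union> \<Phi>\<^sub>1, \<Delta>) \<in> L \<or> (\<Gamma>, \<Delta> \<union> \<Phi>\<^sub>2) \<in> L"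
  shows "(\<Gamma>, \<Delta>) \<in> L"
proof (rule full)
  fix \<Phi>\<^sub>1 \<Phi>\<^sub>2
  assume "\<Phi>\<^sub>1 \<union> \<Phi>\<^sub>2 = \<Phi>"
  from prem[OF this] show "(\<Gamma> \<union> \<Phi>\<^sub>1, \<Delta> \<union> \<Phi>\<^sub>2) \<in> L"
    using weak[of "\<Gamma> \<union> \<Phi>\<^sub>1" \<Delta> "{}" \<Phi>\<^sub>2] weak[of \<Gamma> "\<Delta> \<union> \<Phi>\<^sub>2" \<Phi>\<^sub>1 "{}"] by auto
qed

lemma matrix_logic_weakening:
  "(\<Gamma>, \<Delta>) \<in> matrix_logic K \<Longrightarrow> (\<Gamma> \<union> \<Gamma>', \<Delta> \<union> \<Delta>') \<in> matrix_logic K"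
  unfolding matrix_logic_def by (simp add: image_Un bex_Un)

lemma matrix_logic_full_cut:
  assumes prem: "\<And>\<Phi>\<^sub>1 \<Phi>\<^sub>2. \<Phi>\<^sub>1 \<union> \<Phi>\<^sub>2 = \<Phi> \<Longrightarrow> (\<Gamma> \<union> \<Phi>\<^sub>1, \<Delta> \<union> \<Phi>\<^sub>2) \<in> matrix_logic K"
  shows "(\<Gamma>, \<Delta>) \<in> matrix_logic K"
  unfolding matrix_logic_def
proof clarify
  fix M v
  assume M: "M \<in> K" and v: "range v \<subseteq> carrier M" and \<Gamma>: "eval M v ` \<Gamma> \<subseteq> designated M"
  let ?P = "{\<phi> \<in> \<Phi>. eval M v \<phi> \<in> designated M}"
  have "(\<Gamma> \<union> ?P, \<Delta> \<union> (\<Phi> - ?P)) \<in> matrix_logic K"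
    by (rule prem) blast
  moreover have "eval M v ` (\<Gamma> \<union> ?P) \<subseteq> designated M"
    using \<Gamma> by blast
  ultimately have "\<exists>\<delta> \<in> \<Delta> \<union> (\<Phi> - ?P). eval M v \<delta> \<in> designated M"
    using M v unfolding matrix_logic_def by blast
  then show "\<exists>\<delta> \<in> \<Delta>. eval M v \<delta> \<in> designated M"
    by blast
qed

lemma eval_subst: "eval M v (subst \<sigma> \<phi>) = eval M (\<lambda>x. eval M v (\<sigma> x)) \<phi>"
  by (induction \<phi>) simp_all

lemma eval_in_carrier: "is_matrix M \<Longrightarrow> range v \<subseteq> carrier M \<Longrightarrow> eval M v \<phi> \<in> carrier M"
  by (induction \<phi>) (auto simp: is_matrix_def)

lemma mc_logic_matrix_logic:
  assumes K: "\<And>M. M \<in> K \<Longrightarrow> is_matrix M"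
  shows "mc_logic (matrix_logic K)"
  unfolding mc_logic_def
proof (intro conjI allI impI)
  show "({\<phi>}, {\<phi>}) \<in> matrix_logic K" for \<phi>
    by (auto simp: matrix_logic_def)
next
  fix \<Gamma> \<Delta> \<Gamma>' \<Delta>'
  assume "(\<Gamma>, \<Delta>) \<in> matrix_logic K"
  then show "(\<Gamma> \<union> \<Gamma>', \<Delta> \<union> \<Delta>') \<in> matrix_logic K"
    by (rule matrix_logic_weakening)
next
  fix \<Gamma> \<Delta> \<Phi>
  assume "\<forall>\<Phi>\<^sub>1 \<Phi>\<^sub>2. \<Phi>\<^sub>1 \<union> \<Phi>\<^sub>2 = \<Phi> \<longrightarrow>
    (\<Gamma> \<union> \<Phi>\<^sub>1, \<Delta>) \<in> matrix_logic K \<or> (\<Gamma>, \<Delta> \<union> \<Phi>\<^sub>2) \<in> matrix_logic K"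
  then show "(\<Gamma>, \<Delta>) \<in> matrix_logic K"
    using full_cut_imp_cut[of "matrix_logic K" \<Phi> \<Gamma> \<Delta>, OF matrix_logic_weakening]
      matrix_logic_full_cut[of \<Phi> \<Gamma> \<Delta> K] by simp
next
  fix \<Gamma> \<Delta> \<sigma>
  assume L: "(\<Gamma>, \<Delta>) \<in> matrix_logic K"
  show "(subst \<sigma> ` \<Gamma>, subst \<sigma> ` \<Delta>) \<in> matrix_logic K"
    unfolding matrix_logic_def
  proof clarify
    fix M v
    assume M: "M \<in> K" and v: "range v \<subseteq> carrier M"
      and \<Gamma>: "eval M v ` subst \<sigma> ` \<Gamma> \<subseteq> designated M"
    let ?w = "\<lambda>x. eval M v (\<sigma> x)"
    have "range ?w \<subseteq> carrier M"
      using eval_in_carrier[OF K[OF M] v] by blast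
    moreover have "eval M ?w ` \<Gamma> \<subseteq> designated M"
      using \<Gamma> by (simp add: image_image eval_subst)
    ultimately have "\<exists>\<delta> \<in> \<Delta>. eval M ?w \<delta> \<in> designated M"
      using L M unfolding matrix_logic_def by blast
    then show "\<exists>\<delta> \<in> subst \<sigma> ` \<Delta>. eval M v \<delta> \<in> designated M"
      by (auto simp: eval_subst)
  qed
qed

end

theory Submission
  imports Defs
begin

text \<open>
  A four-valued valuation \<open>v\<close> refuting a rule of an extension \<open>L\<close> of \<open>BD_mc\<close> is turned into a
  substitution sending each variable to \<open>\<top>\<close>, \<open>\<bottom>\<close>, \<open>p\<close> or \<open>q\<close> according to its value \<open>\<top>\<close>,
  \<open>\<bottom>\<close>, \<open>n\<close> or \<open>b\<close>. Any valuation that makes \<open>q \<and> \<sim>q\<close> designated and \<open>p \<or> \<sim>p\<close> undesignated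
  gives \<open>q\<close> the value \<open>b\<close> and \<open>p\<close> the value \<open>n\<close>, so cutting the substituted rule against
  \<open>BD_mc\<close> yields \<open>q \<and> \<sim>q \<turnstile> p \<or> \<sim>p\<close> in \<open>L\<close>, where the left (right) side may be dropped if
  \<open>v\<close> omits \<open>b\<close> (\<open>n\<close>). Hence \<open>L\<close> contains one of these four rules as soon as it fails to lie
  below \<open>BD_mc\<close>, \<open>LP_mc\<close>, \<open>K_mc\<close> or \<open>CL_mc\<close>, and conversely these rules axiomatise \<open>KO_mc\<close>,
  \<open>K_mc\<close>, \<open>LP_mc\<close> and the trivial logic over \<open>BD_mc\<close>.
\<close>

section \<open>Structural rules of multiple-conclusion logics\<close>

lemma mc_logic_weaken:
  assumes "mc_logic L" "(\<Gamma>, \<Delta>) \<in> L" "\<Gamma> \<subseteq> \<Gamma>'" "\<Delta> \<subseteq> \<Delta>'"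
  shows "(\<Gamma>', \<Delta>') \<in> L"
proof -
  have "(\<Gamma> \<union> \<Gamma>', \<Delta> \<union> \<Delta>') \<in> L"
    by (rule assms(1)[unfolded mc_logic_def, THEN conjunct2, THEN conjunct1, rule_format])
      (rule assms(2))
  then show ?thesis
    using assms(3,4) by (simp add: Un_absorb1)
qed

lemma mc_logic_cut:
  assumes "mc_logic L"
    and "\<And>\<Phi>\<^sub>1 \<Phi>\<^sub>2. \<Phi>\<^sub>1 \<union> \<Phi>\<^sub>2 = \<Phi> \<Longrightarrow> (\<Gamma> \<union> \<Phi>\<^sub>1, \<Delta>) \<in> L \<or> (\<Gamma>, \<Delta> \<union> \<Phi>\<^sub>2) \<in> L"
  shows "(\<Gamma>, \<Delta>) \<in> L"
  by (rule assms(1)[unfolded mc_logic_def, THEN conjunct2, THEN conjunct2, THEN conjunct1,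
        rule_format]) (rule assms(2))

lemma mc_logic_subst:
  assumes "mc_logic L" "(\<Gamma>, \<Delta>) \<in> L"
  shows "(subst \<sigma> ` \<Gamma>, subst \<sigma> ` \<Delta>) \<in> L"
  by (rule assms(1)[unfolded mc_logic_def, THEN conjunct2, THEN conjunct2, THEN conjunct2,
        rule_format]) (rule assms(2))

text \<open>If the second part of a cover is empty, its first part is all of \<Phi>. Otherwise one
  formula of the second part suffices, since its premise weakens to the right disjunct of the cut
  rule.\<close>

lemma mc_logic_cut_premises:
  assumes L: "mc_logic L" and "(\<Gamma> \<union> \<Phi>, \<Delta>) \<in> L"
    and "\<And>\<phi>. \<phi> \<in> \<Phi> \<Longrightarrow> (\<Gamma>, insert \<phi> \<Delta>) \<in> L"
  shows "(\<Gamma>, \<Delta>) \<in> L"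
proof (rule mc_logic_cut[OF L, where \<Phi> = \<Phi>])
  fix \<Phi>\<^sub>1 \<Phi>\<^sub>2
  assume cover: "\<Phi>\<^sub>1 \<union> \<Phi>\<^sub>2 = \<Phi>"
  show "(\<Gamma> \<union> \<Phi>\<^sub>1, \<Delta>) \<in> L \<or> (\<Gamma>, \<Delta> \<union> \<Phi>\<^sub>2) \<in> L"
  proof (cases "\<Phi>\<^sub>2 = {}")
    case True
    then show ?thesis using cover assms(2) by simp
  next
    case False
    then obtain \<phi> where \<phi>: "\<phi> \<in> \<Phi>\<^sub>2" by blast
    then have "(\<Gamma>, insert \<phi> \<Delta>) \<in> L" using assms(3) cover by blast
    then have "(\<Gamma>, \<Delta> \<union> \<Phi>\<^sub>2) \<in> L"
      by (rule mc_logic_weaken[OF L]) (use \<phi> in auto)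
    then show ?thesis ..
  qed
qed

lemma mc_logic_cut_conclusions:
  assumes L: "mc_logic L" and "(\<Gamma>, \<Delta> \<union> \<Phi>) \<in> L"
    and "\<And>\<phi>. \<phi> \<in> \<Phi> \<Longrightarrow> (insert \<phi> \<Gamma>, \<Delta>) \<in> L"
  shows "(\<Gamma>, \<Delta>) \<in> L"
proof (rule mc_logic_cut[OF L, where \<Phi> = \<Phi>])
  fix \<Phi>\<^sub>1 \<Phi>\<^sub>2
  assume cover: "\<Phi>\<^sub>1 \<union> \<Phi>\<^sub>2 = \<Phi>"
  show "(\<Gamma> \<union> \<Phi>\<^sub>1, \<Delta>) \<in> L \<or> (\<Gamma>, \<Delta> \<union> \<Phi>\<^sub>2) \<in> L"
  proof (cases "\<Phi>\<^sub>1 = {}")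
    case True
    then show ?thesis using cover assms(2) by simp
  next
    case False
    then obtain \<phi> where \<phi>: "\<phi> \<in> \<Phi>\<^sub>1" by blast
    then have "(insert \<phi> \<Gamma>, \<Delta>) \<in> L" using assms(3) cover by blast
    then have "(\<Gamma> \<union> \<Phi>\<^sub>1, \<Delta>) \<in> L"
      by (rule mc_logic_weaken[OF L]) (use \<phi> in auto)
    then show ?thesis ..
  qed
qed

section \<open>Refutation of rules in submatrices of DM4\<close>

lemma matrix_logic_Un: "matrix_logic (K \<union> K') = matrix_logic K \<inter> matrix_logic K'"
  unfolding matrix_logic_def by blast

abbreviation ev :: "(nat \<Rightarrow> dm4) \<Rightarrow> fm \<Rightarrow> dm4" where
  "ev \<equiv> eval (dm4_matrix UNIV {B4, T4})"

definition des :: "dm4 set" where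
  "des = {B4, T4}"

definition refutes :: "(nat \<Rightarrow> dm4) \<Rightarrow> fm set \<Rightarrow> fm set \<Rightarrow> bool" where
  "refutes v \<Gamma> \<Delta> \<longleftrightarrow> (\<forall>\<gamma> \<in> \<Gamma>. ev v \<gamma> \<in> des) \<and> (\<forall>\<delta> \<in> \<Delta>. ev v \<delta> \<notin> des)"

lemma eval_dm4_matrix: "eval (dm4_matrix A F) v \<phi> = ev v \<phi>"
  by (induction \<phi>) (simp_all add: dm4_matrix_def)

text \<open>Evaluation from a subalgebra stays inside it, and there \<open>F\<close> agrees with
  \<open>des\<close>. So the logics can be compared inside DM4, by the values a refuting valuation
  may take.\<close>

lemma matrix_logic_dm4:
  assumes "is_matrix (dm4_matrix A F)" and F: "F = A \<inter> des"
  shows "(\<Gamma>, \<Delta>) \<in> matrix_logic {dm4_matrix A F} \<longleftrightarrow>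
    (\<forall>v. range v \<subseteq> A \<longrightarrow> \<not> refutes v \<Gamma> \<Delta>)"
proof -
  have "ev v \<phi> \<in> F \<longleftrightarrow> ev v \<phi> \<in> des" if "range v \<subseteq> A" for v \<phi>
  proof -
    have "ev v \<phi> \<in> A"
      using eval_in_carrier[OF assms(1), of v \<phi>] that
      unfolding eval_dm4_matrix[of A F] by (simp add: dm4_matrix_def)
    then show ?thesis unfolding F by blast
  qed
  moreover have "carrier (dm4_matrix A F) = A" "designated (dm4_matrix A F) = F"
    by (simp_all add: dm4_matrix_def)
  ultimately show ?thesis
    unfolding matrix_logic_def refutes_def
    by (simp add: eval_dm4_matrix[of A F] image_subset_iff) blast
qed

lemma range_dm4:
  fixes v :: "nat \<Rightarrow> dm4"
  shows "range v \<subseteq> {F4, N4, T4} \<longleftrightarrow> B4 \<notin> range v"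
    and "range v \<subseteq> {F4, B4, T4} \<longleftrightarrow> N4 \<notin> range v"
    and "range v \<subseteq> {F4, T4} \<longleftrightarrow> B4 \<notin> range v \<and> N4 \<notin> range v"
  by (simp add: image_subset_iff image_iff, metis dm4.nchotomy dm4.distinct)+

lemma BD_iff: "(\<Gamma>, \<Delta>) \<in> BD_mc \<longleftrightarrow> (\<forall>v. \<not> refutes v \<Gamma> \<Delta>)"
  unfolding BD_mc_def by (subst matrix_logic_dm4[OF is_matrix_BD]) (auto simp: des_def)

lemma K_iff: "(\<Gamma>, \<Delta>) \<in> K_mc \<longleftrightarrow> (\<forall>v. B4 \<notin> range v \<longrightarrow> \<not> refutes v \<Gamma> \<Delta>)"
  unfolding K_mc_def range_dm4(1)[symmetric]
  by (rule matrix_logic_dm4[OF is_matrix_K]) (auto simp: des_def)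

lemma LP_iff: "(\<Gamma>, \<Delta>) \<in> LP_mc \<longleftrightarrow> (\<forall>v. N4 \<notin> range v \<longrightarrow> \<not> refutes v \<Gamma> \<Delta>)"
  unfolding LP_mc_def range_dm4(2)[symmetric]
  by (rule matrix_logic_dm4[OF is_matrix_LP]) (auto simp: des_def)

lemma CL_iff:
  "(\<Gamma>, \<Delta>) \<in> CL_mc \<longleftrightarrow> (\<forall>v. B4 \<notin> range v \<and> N4 \<notin> range v \<longrightarrow> \<not> refutes v \<Gamma> \<Delta>)"
  unfolding CL_mc_def range_dm4(3)[symmetric]
  by (rule matrix_logic_dm4[OF is_matrix_CL]) (auto simp: des_def)

lemma mc_logic_K: "mc_logic K_mc" and mc_logic_LP: "mc_logic LP_mc"
  and mc_logic_CL: "mc_logic CL_mc" and mc_logic_KO: "mc_logic KO_mc"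
  \<comment> \<open>The intersection \<open>KO_mc\<close> becomes the logic of a class of two
    matrices, so the general result on matrix logics covers it too.\<close>
  unfolding K_mc_def LP_mc_def CL_mc_def KO_mc_def matrix_logic_Un[symmetric]
  by (rule mc_logic_matrix_logic; auto simp: is_matrix_K is_matrix_LP is_matrix_CL)+

section \<open>Formulas detecting the values b and n\<close>

definition contra :: "nat \<Rightarrow> fm" where
  "contra x = Conj (Var x) (Neg (Var x))"

definition excl_mid :: "nat \<Rightarrow> fm" where
  "excl_mid x = Disj (Var x) (Neg (Var x))"

lemma designated_contra: "ev v (contra x) \<in> des \<longleftrightarrow> v x = B4"
  by (cases "v x") (simp_all add: contra_def dm4_matrix_def inf_dm4_def less_eq_dm4_def des_def)

lemma designated_excl_mid: "ev v (excl_mid x) \<in> des \<longleftrightarrow> v x \<noteq> N4"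
  by (cases "v x") (simp_all add: excl_mid_def dm4_matrix_def sup_dm4_def less_eq_dm4_def des_def)

lemma refutes_Un: "refutes v (\<Gamma> \<union> \<Gamma>') (\<Delta> \<union> \<Delta>') \<longleftrightarrow> refutes v \<Gamma> \<Delta> \<and> refutes v \<Gamma>' \<Delta>'"
  unfolding refutes_def by blast

text \<open>As extra conclusions, the contradictions turn a rule of \<open>K_mc\<close> into one of
  \<open>BD_mc\<close>. The family runs over all variables because any of them may take the value
  b.\<close>

lemma refutes_contra: "refutes v {} (range contra) \<longleftrightarrow> B4 \<notin> range v"
  by (simp add: refutes_def designated_contra image_iff) metis

lemma refutes_excl_mid: "refutes v (range excl_mid) {} \<longleftrightarrow> N4 \<notin> range v"
  by (simp add: refutes_def designated_excl_mid image_iff) metis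

section \<open>Encoding a valuation by a substitution\<close>

fun value_code :: "dm4 \<Rightarrow> fm" where
  "value_code F4 = Falsum"
| "value_code N4 = Var 0"
| "value_code B4 = Var 1"
| "value_code T4 = Verum"

text \<open>The classical values are coded by constants, which every \<open>w\<close> evaluates
  correctly. Only the two variable codes constrain \<open>w\<close>, each only when \<open>v\<close>
  uses its value.\<close>

lemma ev_value_code:
  assumes "B4 \<in> range v \<Longrightarrow> w 1 = B4" and "N4 \<in> range v \<Longrightarrow> w 0 = N4"
  shows "ev w (subst (value_code \<circ> v) \<phi>) = ev v \<phi>"
proof -
  have "ev w (value_code (v x)) = v x" for x
  proof (cases "v x")
    case N4
    then show ?thesis using assms(2) by (metis eval.simps(1) rangeI value_code.simps(2))
  next
    case B4
    then show ?thesis using assms(1) by (metis eval.simps(1) rangeI value_code.simps(3))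
  qed (simp_all add: dm4_matrix_def bot_dm4_def top_dm4_def)
  then show ?thesis by (simp add: eval_subst)
qed

lemma extension_refuted_rule:
  assumes ext: "mc_extension BD_mc L" and rule: "(\<Gamma>, \<Delta>) \<in> L" and v: "refutes v \<Gamma> \<Delta>"
  shows "(if B4 \<in> range v then {contra 1} else {}, if N4 \<in> range v then {excl_mid 0} else {}) \<in> L"
    (is "(?\<Gamma>, ?\<Delta>) \<in> L")
proof -
  have L: "mc_logic L" and BD: "BD_mc \<subseteq> L"
    using ext by (simp_all add: mc_extension_def)
  let ?s = "subst (value_code \<circ> v)"
  \<comment> \<open>Refuting the side formulas forces \<open>w\<close> to give \<open>Var 1\<close>
    the value b and \<open>Var 0\<close> the value n whenever \<open>v\<close> uses these
    values.\<close>
  have key: "ev w (?s \<phi>) = ev v \<phi>" if "refutes w ?\<Gamma> ?\<Delta>" for w \<phi>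
    by (rule ev_value_code)
      (use that in \<open>simp_all add: refutes_def designated_contra designated_excl_mid\<close>)
  have premise: "(?\<Gamma>, insert (?s \<gamma>) ?\<Delta>) \<in> BD_mc" if "\<gamma> \<in> \<Gamma>" for \<gamma>
  proof -
    \<comment> \<open>By \<open>key\<close>, \<open>w\<close> designates the substituted premise
      just as \<open>v\<close> designates \<gamma>. Writing \<open>{}\<close> explicitly lets
      \<open>refutes_Un\<close> split off this formula.\<close>
    have "\<not> refutes w ({} \<union> ?\<Gamma>) ({?s \<gamma>} \<union> ?\<Delta>)" for w
      unfolding refutes_Un using key[of w \<gamma>] v that unfolding refutes_def[of v]
        refutes_def[of w "{}"] by fastforce
    then show ?thesis by (simp add: BD_iff)
  qed
  have conclusion: "(insert (?s \<delta>) ?\<Gamma>, ?\<Delta>) \<in> BD_mc" if "\<delta> \<in> \<Delta>" for \<delta>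
  proof -
    have "\<not> refutes w ({?s \<delta>} \<union> ?\<Gamma>) ({} \<union> ?\<Delta>)" for w
      unfolding refutes_Un using key[of w \<delta>] v that unfolding refutes_def[of v]
        refutes_def[of w _ "{}"] by fastforce
    then show ?thesis by (simp add: BD_iff)
  qed
  have "(?\<Gamma> \<union> ?s ` \<Gamma>, ?\<Delta> \<union> ?s ` \<Delta>) \<in> L"
    by (rule mc_logic_weaken[OF L mc_logic_subst[OF L rule, of "value_code \<circ> v"]]) blast+
  then have "(?\<Gamma>, ?\<Delta> \<union> ?s ` \<Delta>) \<in> L"
  proof (rule mc_logic_cut_premises[OF L])
    fix \<phi> assume "\<phi> \<in> ?s ` \<Gamma>"
    then have "(?\<Gamma>, insert \<phi> ?\<Delta>) \<in> L"
      using premise BD by blast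
    then show "(?\<Gamma>, insert \<phi> (?\<Delta> \<union> ?s ` \<Delta>)) \<in> L"
      by (rule mc_logic_weaken[OF L]) blast+
  qed
  then show ?thesis
  proof (rule mc_logic_cut_conclusions[OF L])
    fix \<phi> assume "\<phi> \<in> ?s ` \<Delta>"
    then show "(insert \<phi> ?\<Gamma>, ?\<Delta>) \<in> L"
      using conclusion BD by blast
  qed
qed

section \<open>Axiomatisations over BD\<close>

lemma contra_excl_mid_rename:
  assumes "mc_logic L"
  shows "({contra 1}, {}) \<in> L \<Longrightarrow> ({contra x}, {}) \<in> L"
    and "({}, {excl_mid 0}) \<in> L \<Longrightarrow> ({}, {excl_mid y}) \<in> L"
    and "({contra 1}, {excl_mid 0}) \<in> L \<Longrightarrow> ({contra x}, {excl_mid y}) \<in> L"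
  \<comment> \<open>Sending 0 to \<open>y\<close> and every other index to \<open>x\<close> renames
    both formulas at once, even if \<open>x\<close> and \<open>y\<close> coincide.\<close>
  by (drule mc_logic_subst[OF assms, where \<sigma> = "\<lambda>n. Var (if n = 0 then y else x)"],
      simp add: contra_def excl_mid_def)+

text \<open>A rule of \<open>K_mc\<close> holds in \<open>BD_mc\<close> with all contradictions as
  extra conclusions, and the assumed rule cuts each of them away.\<close>

lemma K_subset_extension:
  assumes ext: "mc_extension BD_mc L" and rule: "({contra 1}, {}) \<in> L"
  shows "K_mc \<subseteq> L"
proof clarify
  fix \<Gamma> \<Delta> assume "(\<Gamma>, \<Delta>) \<in> K_mc"
  then have "(\<Gamma> \<union> {}, \<Delta> \<union> range contra) \<in> BD_mc"
    unfolding BD_iff K_iff refutes_Un refutes_contra by blast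
  moreover have L: "mc_logic L" and "BD_mc \<subseteq> L"
    using ext by (simp_all add: mc_extension_def)
  ultimately have "(\<Gamma>, \<Delta> \<union> range contra) \<in> L" by auto
  then show "(\<Gamma>, \<Delta>) \<in> L"
  proof (rule mc_logic_cut_conclusions[OF L])
    fix \<phi> assume "\<phi> \<in> range contra"
    then obtain x where "\<phi> = contra x" by blast
    then show "(insert \<phi> \<Gamma>, \<Delta>) \<in> L"
      by (intro mc_logic_weaken[OF L contra_excl_mid_rename(1)[OF L rule, of x]]) simp_all
  qed
qed

lemma LP_subset_extension:
  assumes ext: "mc_extension BD_mc L" and rule: "({}, {excl_mid 0}) \<in> L"
  shows "LP_mc \<subseteq> L"
proof clarify
  fix \<Gamma> \<Delta> assume "(\<Gamma>, \<Delta>) \<in> LP_mc"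
  then have "(\<Gamma> \<union> range excl_mid, \<Delta> \<union> {}) \<in> BD_mc"
    unfolding BD_iff LP_iff refutes_Un refutes_excl_mid by blast
  moreover have L: "mc_logic L" and "BD_mc \<subseteq> L"
    using ext by (simp_all add: mc_extension_def)
  ultimately have "(\<Gamma> \<union> range excl_mid, \<Delta>) \<in> L" by auto
  then show "(\<Gamma>, \<Delta>) \<in> L"
  proof (rule mc_logic_cut_premises[OF L])
    fix \<phi> assume "\<phi> \<in> range excl_mid"
    then obtain y where "\<phi> = excl_mid y" by blast
    then show "(\<Gamma>, insert \<phi> \<Delta>) \<in> L"
      by (intro mc_logic_weaken[OF L contra_excl_mid_rename(2)[OF L rule, of y]]) simp_all
  qed
qed

lemma KO_subset_extension:
  assumes ext: "mc_extension BD_mc L" and rule: "({contra 1}, {excl_mid 0}) \<in> L"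
  shows "KO_mc \<subseteq> L"
proof clarify
  fix \<Gamma> \<Delta> assume KO: "(\<Gamma>, \<Delta>) \<in> KO_mc"
  have L: "mc_logic L" and BD: "BD_mc \<subseteq> L"
    using ext by (simp_all add: mc_extension_def)
  have "(\<Gamma> \<union> {}, \<Delta> \<union> range contra) \<in> BD_mc"
    using KO unfolding KO_mc_def BD_iff Int_iff K_iff refutes_Un refutes_contra by blast
  then have contras: "(\<Gamma>, \<Delta> \<union> range contra) \<in> L" using BD by auto
  have "(\<Gamma> \<union> range excl_mid, \<Delta> \<union> {}) \<in> BD_mc"
    using KO unfolding KO_mc_def BD_iff Int_iff LP_iff refutes_Un refutes_excl_mid by blast
  then have "(\<Gamma> \<union> range excl_mid, \<Delta>) \<in> L" using BD by auto
  then show "(\<Gamma>, \<Delta>) \<in> L"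
  proof (rule mc_logic_cut_premises[OF L])
    fix \<phi> assume "\<phi> \<in> range excl_mid"
    then obtain y where \<phi>: "\<phi> = excl_mid y" by blast
    \<comment> \<open>Two cuts are nested: with the excluded middle \<phi> kept on the right, each
      contradiction is cut away because it entails \<phi>.\<close>
    have "(\<Gamma>, insert \<phi> \<Delta> \<union> range contra) \<in> L"
      by (rule mc_logic_weaken[OF L contras]) auto
    then show "(\<Gamma>, insert \<phi> \<Delta>) \<in> L"
    proof (rule mc_logic_cut_conclusions[OF L])
      fix \<psi> assume "\<psi> \<in> range contra"
      then obtain x where "\<psi> = contra x" by blast
      then show "(insert \<psi> \<Gamma>, insert \<phi> \<Delta>) \<in> L"
        by (intro mc_logic_weaken[OF L contra_excl_mid_rename(3)[OF L rule, of x y]]) (simp_all add: \<phi>)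
    qed
  qed
qed

text \<open>With all excluded middles as premises, a classical rule holds in \<open>K_mc\<close>,
  since its refuting valuations would avoid both n and b. These premises are theorems of
  \<open>LP_mc\<close>.\<close>

lemma CL_subset_extension:
  assumes L: "mc_logic L" and "K_mc \<subseteq> L" and "LP_mc \<subseteq> L"
  shows "CL_mc \<subseteq> L"
proof clarify
  fix \<Gamma> \<Delta> assume "(\<Gamma>, \<Delta>) \<in> CL_mc"
  then have "(\<Gamma> \<union> range excl_mid, \<Delta> \<union> {}) \<in> K_mc"
    unfolding CL_iff K_iff refutes_Un refutes_excl_mid by blast
  then have "(\<Gamma> \<union> range excl_mid, \<Delta>) \<in> L" using assms(2) by auto
  then show "(\<Gamma>, \<Delta>) \<in> L"
  proof (rule mc_logic_cut_premises[OF L])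
    fix \<phi> assume "\<phi> \<in> range excl_mid"
    then have "({}, {\<phi>}) \<in> LP_mc"
      by (auto simp: LP_iff refutes_def designated_excl_mid) (metis rangeI)
    then have "({}, {\<phi>}) \<in> L"
      using assms(3) by blast
    then show "(\<Gamma>, insert \<phi> \<Delta>) \<in> L"
      by (rule mc_logic_weaken[OF L]) simp_all
  qed
qed

section \<open>Classification of the extensions\<close>

lemma exists_refuted_rule:
  shows "L \<noteq> BD_mc \<Longrightarrow> BD_mc \<subseteq> L \<Longrightarrow> \<exists>\<Gamma> \<Delta> v. (\<Gamma>, \<Delta>) \<in> L \<and> refutes v \<Gamma> \<Delta>"
    and "\<not> L \<subseteq> K_mc \<Longrightarrow> \<exists>\<Gamma> \<Delta> v. (\<Gamma>, \<Delta>) \<in> L \<and> refutes v \<Gamma> \<Delta> \<and> B4 \<notin> range v"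
    and "\<not> L \<subseteq> LP_mc \<Longrightarrow> \<exists>\<Gamma> \<Delta> v. (\<Gamma>, \<Delta>) \<in> L \<and> refutes v \<Gamma> \<Delta> \<and> N4 \<notin> range v"
    and "\<not> L \<subseteq> CL_mc \<Longrightarrow>
      \<exists>\<Gamma> \<Delta> v. (\<Gamma>, \<Delta>) \<in> L \<and> refutes v \<Gamma> \<Delta> \<and> B4 \<notin> range v \<and> N4 \<notin> range v"
proof -
  show "\<exists>\<Gamma> \<Delta> v. (\<Gamma>, \<Delta>) \<in> L \<and> refutes v \<Gamma> \<Delta>" if *: "L \<noteq> BD_mc" "BD_mc \<subseteq> L"
  proof -
    obtain \<Gamma> \<Delta> where "(\<Gamma>, \<Delta>) \<in> L" "(\<Gamma>, \<Delta>) \<notin> BD_mc"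
      using * by auto
    then show ?thesis unfolding BD_iff by blast
  qed
qed (unfold subset_iff split_paired_All K_iff LP_iff CL_iff, blast+)

text \<open>The pairing is crosswise: a valuation witnessing failure of inclusion in
  \<open>LP_mc\<close> avoids n, so the right side of the extracted rule is empty and the
  contradiction rule of \<open>K_mc\<close> appears. Dually for \<open>K_mc\<close>.\<close>

lemma extension_dichotomies:
  assumes ext: "mc_extension BD_mc L"
  shows "L \<noteq> BD_mc \<Longrightarrow> KO_mc \<subseteq> L"
    and "\<not> L \<subseteq> LP_mc \<Longrightarrow> K_mc \<subseteq> L"
    and "\<not> L \<subseteq> K_mc \<Longrightarrow> LP_mc \<subseteq> L"
    and "\<not> L \<subseteq> CL_mc \<Longrightarrow> L = trivial_mc"
proof -
  have L: "mc_logic L" and BD: "BD_mc \<subseteq> L"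
    using ext by (simp_all add: mc_extension_def)
  note refuted = extension_refuted_rule[OF ext]
  show "KO_mc \<subseteq> L" if *: "L \<noteq> BD_mc"
  proof -
    obtain \<Gamma> \<Delta> v where "(\<Gamma>, \<Delta>) \<in> L" "refutes v \<Gamma> \<Delta>"
      using exists_refuted_rule(1)[OF * BD] by blast
    have "({contra 1}, {excl_mid 0}) \<in> L"
      by (rule mc_logic_weaken[OF L refuted[OF \<open>(\<Gamma>, \<Delta>) \<in> L\<close> \<open>refutes v \<Gamma> \<Delta>\<close>]]) simp_all
    then show ?thesis
      by (rule KO_subset_extension[OF ext])
  qed
  show "K_mc \<subseteq> L" if *: "\<not> L \<subseteq> LP_mc"
  proof -
    obtain \<Gamma> \<Delta> v where "(\<Gamma>, \<Delta>) \<in> L" "refutes v \<Gamma> \<Delta>" and v: "N4 \<notin> range v"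
      using exists_refuted_rule(3)[OF *] by blast
    have "({contra 1}, {}) \<in> L"
      by (rule mc_logic_weaken[OF L refuted[OF \<open>(\<Gamma>, \<Delta>) \<in> L\<close> \<open>refutes v \<Gamma> \<Delta>\<close>]]) (simp_all add: v)
    then show ?thesis
      by (rule K_subset_extension[OF ext])
  qed
  show "LP_mc \<subseteq> L" if *: "\<not> L \<subseteq> K_mc"
  proof -
    obtain \<Gamma> \<Delta> v where "(\<Gamma>, \<Delta>) \<in> L" "refutes v \<Gamma> \<Delta>" and v: "B4 \<notin> range v"
      using exists_refuted_rule(2)[OF *] by blast
    have "({}, {excl_mid 0}) \<in> L"
      by (rule mc_logic_weaken[OF L refuted[OF \<open>(\<Gamma>, \<Delta>) \<in> L\<close> \<open>refutes v \<Gamma> \<Delta>\<close>]]) (simp_all add: v)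
    then show ?thesis
      by (rule LP_subset_extension[OF ext])
  qed
  show "L = trivial_mc" if *: "\<not> L \<subseteq> CL_mc"
  proof -
    obtain \<Gamma> \<Delta> v where "(\<Gamma>, \<Delta>) \<in> L" "refutes v \<Gamma> \<Delta>" and v: "B4 \<notin> range v" "N4 \<notin> range v"
      using exists_refuted_rule(4)[OF *] by blast
    \<comment> \<open>A two-valued \<open>v\<close> empties both sides, and the empty rule weakens
      to every pair.\<close>
    from refuted[OF this(1,2)] v have "({}, {}) \<in> L" by simp
    then show ?thesis
      using mc_logic_weaken[OF L] by (auto simp: trivial_mc_def)
  qed
qed

lemma KO_proper_extension: "mc_extension BD_mc KO_mc" "KO_mc \<noteq> BD_mc"
proof -
  have "BD_mc \<subseteq> KO_mc"
    by (auto simp: KO_mc_def BD_iff K_iff LP_iff)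
  then show "mc_extension BD_mc KO_mc"
    by (simp add: mc_extension_def mc_logic_KO)
  \<comment> \<open>A refutation needs both b and n as values, whereas each of the two intersected
    logics forbids one of them.\<close>
  have "({contra 1}, {excl_mid 0}) \<in> KO_mc"
    by (auto simp: KO_mc_def K_iff LP_iff refutes_def designated_contra designated_excl_mid
        image_iff) metis+
  moreover have "refutes (\<lambda>x. if x = 0 then N4 else B4) {contra 1} {excl_mid 0}"
    by (simp add: refutes_def designated_contra designated_excl_mid)
  then have "({contra 1}, {excl_mid 0}) \<notin> BD_mc"
    unfolding BD_iff by blast
  ultimately show "KO_mc \<noteq> BD_mc" by blast
qed

text \<open>Equality with \<open>BD_mc\<close> would squeeze \<open>KO_mc\<close> down to it, and
  the empty rule fails even classically.\<close>

lemma proper_nontrivial_between: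
  assumes "mc_logic L" "KO_mc \<subseteq> L" "L \<subseteq> CL_mc"
  shows "mc_extension BD_mc L \<and> L \<noteq> BD_mc \<and> L \<noteq> trivial_mc"
proof -
  have "refutes (\<lambda>_. T4) {} {}" by (simp add: refutes_def)
  then have "({}, {}) \<notin> CL_mc"
    unfolding CL_iff by auto
  then show ?thesis
    using assms KO_proper_extension unfolding mc_extension_def trivial_mc_def by blast
qed

theorem theorem7p4:
  "{L. mc_extension BD_mc L \<and> L \<noteq> BD_mc \<and> L \<noteq> trivial_mc} = {KO_mc, K_mc, LP_mc, CL_mc}"
proof (intro set_eqI iffI)
  fix L
  assume "L \<in> {L. mc_extension BD_mc L \<and> L \<noteq> BD_mc \<and> L \<noteq> trivial_mc}"
  then have ext: "mc_extension BD_mc L" and "L \<noteq> BD_mc" "L \<noteq> trivial_mc" by simp_all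
  then have KO: "LP_mc \<inter> K_mc \<subseteq> L" and CL: "L \<subseteq> CL_mc"
    using extension_dichotomies(1,4)[OF ext] unfolding KO_mc_def by metis+
  have "CL_mc \<subseteq> L" if "K_mc \<subseteq> L" "LP_mc \<subseteq> L"
    using ext that by (intro CL_subset_extension) (simp_all add: mc_extension_def)
  \<comment> \<open>The four cases are whether \<open>L\<close> lies below \<open>LP_mc\<close> and
    below \<open>K_mc\<close>. Not lying below one means containing the other; lying below neither,
    \<open>L\<close> contains both and hence \<open>CL_mc\<close>.\<close>
  then consider "L = LP_mc \<inter> K_mc" | "L = K_mc" | "L = LP_mc" | "L = CL_mc"
    using KO CL extension_dichotomies(2,3)[OF ext] by (metis Int_greatest subset_antisym)
  then show "L \<in> {KO_mc, K_mc, LP_mc, CL_mc}"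
    by cases (simp_all add: KO_mc_def)
next
  fix L
  assume L: "L \<in> {KO_mc, K_mc, LP_mc, CL_mc}"
  have "K_mc \<subseteq> CL_mc" "LP_mc \<subseteq> CL_mc"
    by (auto simp: K_iff LP_iff CL_iff)
  with L have "KO_mc \<subseteq> L" "L \<subseteq> CL_mc"
    by (auto simp: KO_mc_def)
  moreover have "mc_logic L"
    using L mc_logic_K mc_logic_LP mc_logic_CL mc_logic_KO by blast
  ultimately show "L \<in> {L. mc_extension BD_mc L \<and> L \<noteq> BD_mc \<and> L \<noteq> trivial_mc}"
    using proper_nontrivial_between by blast
qed

end
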